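(* For every $\varepsilon > 0$ and every $t \in \mathbb{N}$ there exists a constant $C$ such that the following holds. Let $p = p(n) \in [0,1]$ satisfy $p > C/n^t$, and let $m := \binom{n}{\lfloor n/2 \rfloor}$. Then, with high probability, the largest antichain contained in the random family $\mathcal{P}(n,p)$ has size at most $(1+\varepsilon) p m t$.
   Context: $\mathbb{N} = \{1,2,\dots\}$. For $n \in \mathbb{N}$, $[n] = \{1,\dots,n\}$ and $\mathcal{P}(n)$ denotes the power set of $[n]$. A family $\mathcal{A} \subseteq \mathcal{P}(n)$ is an antichain if for any $A, B \in \mathcal{A}$ with $A \subseteq B$ we have $A = B$. For $p \in [0,1]$, $\mathcal{P}(n,p)$ is the random subset of $\mathcal{P}(n)$ obtained by selecting each element of $\mathcal{P}(n)$ with probability $p$, independently of all other choices. "With high probability" means with probability tending to $1$ as $n \to \infty$ (with $\varepsilon$ and $t$ fixed). *)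

theory Defs
  imports "HOL-Probability.Probability"
begin

definition antichain :: "'a set set \<Rightarrow> bool" where
  "antichain \<A> \<longleftrightarrow> (\<forall>A\<in>\<A>. \<forall>B\<in>\<A>. A \<subseteq> B \<longrightarrow> A = B)"

(* The set under Max contains 0 (empty antichain), and is finite whenever \<F> is finite. *)
definition largest_antichain_size :: "'a set set \<Rightarrow> nat" where
  "largest_antichain_size \<F> = Max (card ` {\<A>. \<A> \<subseteq> \<F> \<and> antichain \<A>})"

(* For p outside [0,1], bernoulli_pmf clamps p to [0,1]. *)
definition random_family :: "nat \<Rightarrow> real \<Rightarrow> nat set set pmf" where
  "random_family n p =
     map_pmf (\<lambda>f. {A \<in> Pow {1..n}. f A})
       (Pi_pmf (Pow {1..n}) False (\<lambda>_. bernoulli_pmf p))"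

end

theory Submission
  imports Defs "HOL-Combinatorics.Multiset_Permutations" "HOL-Real_Asymp.Real_Asymp"
begin

text \<open>
  Let \<open>\<alpha>(\<F>)\<close> be the size of a largest antichain in \<open>\<F>\<close>, let \<open>R\<close> be the random family, fix
  \<open>\<lambda> > 1\<close>, and put \<open>W(\<F>) = E [\<lambda> ^ \<alpha>(R \<inter> \<F>)]\<close>. Distinguishing whether a largest antichain
  uses a given \<open>v \<in> \<F>\<close> gives \<open>W(\<F>) \<le> W(\<F> - v) + p \<lambda> W(\<F> - v - {B. v \<subset> B})\<close>. If every
  family with more than \<open>N\<close> members has a member with at least \<open>d\<close> proper supersets in the family,
  the recursion shows that enlarging a family of size \<open>N\<close> by \<open>k\<close> sets costs at most a factor
  \<open>exp (x k)\<close>, for any \<open>x\<close> with \<open>p \<lambda> exp (- x d) \<le> x\<close>. This replaces the container lemma.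

  Counting pairs on a random maximal chain shows that families with more than \<open>(s + \<delta>) m\<close> members
  have such a \<open>d\<close> of order \<open>n ^ s\<close>. Descend from the full power set to size \<open>(t + 3 + \<delta>) m\<close> with
  \<open>s = t + 3\<close> and \<open>x = n ^ - (t + 2)\<close>; as \<open>2 ^ n \<le> (n + 1) m\<close>, this costs \<open>exp (o(p m))\<close>.
  Then descend to size \<open>(t + \<delta>) m\<close> with \<open>s = t\<close> and \<open>x = \<delta>' p\<close>, which is admissible once
  \<open>p n ^ t\<close> is large. For families of size at most \<open>(t + \<delta>) m\<close> use \<open>\<alpha>(R \<inter> \<F>) \<le> |R \<inter> \<F>|\<close>,
  and conclude with Markov's inequality.
\<close>

section \<open>Random subsets\<close>

text \<open>The expectation of \<open>g R\<close> when \<open>R\<close> contains each element of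
  \<open>F\<close> independently with probability \<open>p\<close>. As a finite sum it needs no
  integrability, and its algebraic identities hold for every real \<open>p\<close>.\<close>

definition subset_expectation :: "real \<Rightarrow> 'a set \<Rightarrow> ('a set \<Rightarrow> real) \<Rightarrow> real" where
  "subset_expectation p F g = (\<Sum>R\<in>Pow F. p ^ card R * (1 - p) ^ card (F - R) * g R)"

lemma subset_expectation_empty [simp]: "subset_expectation p {} g = g {}"
  by (simp add: subset_expectation_def)

text \<open>Conditioning on whether \<open>v\<close> is selected; this is the induction step for the
  other identities.\<close>

lemma subset_expectation_insert:
  assumes "finite F" "v \<notin> F"
  shows "subset_expectation p (insert v F) g =
    (1 - p) * subset_expectation p F g + p * subset_expectation p F (\<lambda>R. g (insert v R))"
proof -
  let ?w = "\<lambda>R. p ^ card R * (1 - p) ^ card (insert v F - R) * g R"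
  have "subset_expectation p (insert v F) g = sum ?w (Pow F) + sum ?w (insert v ` Pow F)"
    unfolding subset_expectation_def Pow_insert
    using assms by (intro sum.union_disjoint) auto
  also have "sum ?w (Pow F) = (1 - p) * subset_expectation p F g"
    unfolding subset_expectation_def sum_distrib_left
  proof (rule sum.cong)
    fix R assume "R \<in> Pow F"
    then have "insert v F - R = insert v (F - R)" using assms by auto
    then show "?w R = (1 - p) * (p ^ card R * (1 - p) ^ card (F - R) * g R)"
      using assms by simp
  qed simp
  also have "sum ?w (insert v ` Pow F) = (\<Sum>R\<in>Pow F. ?w (insert v R))"
    using assms by (intro sum.reindex_cong[of "insert v"]) (auto simp: inj_on_def)
  also have "\<dots> = p * subset_expectation p F (\<lambda>R. g (insert v R))"
    unfolding subset_expectation_def sum_distrib_left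
  proof (rule sum.cong)
    fix R assume R: "R \<in> Pow F"
    then have "insert v F - insert v R = F - R" "v \<notin> R" "finite R"
      using assms by (auto intro: finite_subset)
    then show "?w (insert v R) = p * (p ^ card R * (1 - p) ^ card (F - R) * g (insert v R))"
      by simp
  qed simp
  finally show ?thesis .
qed

lemma subset_expectation_mono:
  assumes "0 \<le> p" "p \<le> 1" "\<And>R. R \<subseteq> F \<Longrightarrow> g R \<le> h R"
  shows "subset_expectation p F g \<le> subset_expectation p F h"
  unfolding subset_expectation_def using assms
  by (intro sum_mono mult_left_mono) auto

lemma subset_expectation_add:
  "subset_expectation p F (\<lambda>R. g R + h R) = subset_expectation p F g + subset_expectation p F h"
  by (simp add: subset_expectation_def sum.distrib distrib_left)

lemma subset_expectation_cmult:
  "subset_expectation p F (\<lambda>R. c * g R) = c * subset_expectation p F g"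
  by (simp add: subset_expectation_def sum_distrib_left mult.left_commute)

text \<open>Discarding the elements of \<open>N\<close> from a random subset of \<open>F\<close>
  leaves a random subset of \<open>F - N\<close>: the two outcomes for an element of
  \<open>N\<close> have total weight 1.\<close>

lemma subset_expectation_restrict:
  assumes "finite F"
  shows "subset_expectation p F (\<lambda>R. g (R - N)) = subset_expectation p (F - N) g"
  using assms
proof (induction F arbitrary: g rule: finite_induct)
  case (insert v F)
  show ?case
  proof (cases "v \<in> N")
    case True
    then show ?thesis
      using insert by (simp add: subset_expectation_insert algebra_simps)
  next
    case False
    have "subset_expectation p F (\<lambda>R. g (insert v R - N)) =
          subset_expectation p F (\<lambda>R. g (insert v (R - N)))"
      using False by (simp add: insert_Diff_if)
    also have "\<dots> = subset_expectation p (F - N) (\<lambda>R. g (insert v R))"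
      by (rule insert.IH)
    finally show ?thesis
      using insert False by (simp add: subset_expectation_insert insert_Diff_if)
  qed
qed simp

text \<open>The generating function of the binomial distribution: each element contributes an
  independent factor \<open>(1 - p) + p * c\<close>.\<close>

lemma subset_expectation_power_card:
  assumes "finite F"
  shows "subset_expectation p F (\<lambda>R. c ^ card R) = (1 + p * (c - 1)) ^ card F"
  using assms
proof (induction F rule: finite_induct)
  case (insert v F)
  have "subset_expectation p F (\<lambda>R. c ^ card (insert v R)) =
        subset_expectation p F (\<lambda>R. c * c ^ card R)"
    unfolding subset_expectation_def
  proof (rule sum.cong)
    fix R assume "R \<in> Pow F"
    then have "v \<notin> R" "finite R" using insert by (auto intro: finite_subset)
    then show "p ^ card R * (1 - p) ^ card (F - R) * c ^ card (insert v R) =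
      p ^ card R * (1 - p) ^ card (F - R) * (c * c ^ card R)" by simp
  qed simp
  then show ?case
    using insert by (simp add: subset_expectation_insert subset_expectation_cmult algebra_simps)
qed simp

lemma expectation_random_subset:
  assumes "finite F" "0 \<le> p" "p \<le> 1"
  shows "measure_pmf.expectation
      (map_pmf (\<lambda>f. {x \<in> F. f x}) (Pi_pmf F False (\<lambda>_. bernoulli_pmf p))) g =
    subset_expectation p F g"
  using assms(1)
proof (induction F arbitrary: g rule: finite_induct)
  case (insert v F)
  let ?P = "\<lambda>A. map_pmf (\<lambda>f. {x \<in> A. f x}) (Pi_pmf A False (\<lambda>_. bernoulli_pmf p))"
  \<comment> \<open>Sampling the coordinate of \<open>v\<close> first makes the two outcomes of one
    Bernoulli trial match the two terms of \<open>subset_expectation_insert\<close>.\<close>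
  have eq: "?P (insert v F) = bernoulli_pmf p \<bind>
      (\<lambda>b. map_pmf (\<lambda>R. if b then insert v R else R) (?P F))"
    using insert.hyps
    by (auto simp: Pi_pmf_insert' map_bind_pmf map_pmf_def[symmetric] pmf.map_comp o_def
        intro!: bind_pmf_cong map_pmf_cong split: if_splits)
  have fin: "finite (set_pmf (?P F))"
    by (rule finite_subset[of _ "Pow F"]) (use insert.hyps in auto)
  have "measure_pmf.expectation (?P (insert v F)) g =
      (1 - p) * measure_pmf.expectation (?P F) g
      + p * measure_pmf.expectation (?P F) (\<lambda>R. g (insert v R))"
    unfolding eq using assms(2,3) fin
    by (subst pmf_expectation_bind[where A = UNIV]) (auto simp: UNIV_bool)
  also have "\<dots> = subset_expectation p (insert v F) g"
    by (simp only: insert.IH subset_expectation_insert[OF insert.hyps])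
  finally show ?case .
qed simp

section \<open>Exponential moments of the largest antichain\<close>

lemma antichain_subset: "antichain \<A> \<Longrightarrow> \<B> \<subseteq> \<A> \<Longrightarrow> antichain \<B>"
  unfolding antichain_def by (meson subsetD)

lemma largest_antichain_size_ge:
  assumes "finite \<F>" "\<A> \<subseteq> \<F>" "antichain \<A>"
  shows "card \<A> \<le> largest_antichain_size \<F>"
proof -
  have "finite {\<A>. \<A> \<subseteq> \<F> \<and> antichain \<A>}"
    by (rule finite_subset[of _ "Pow \<F>"]) (use assms in auto)
  then show ?thesis
    unfolding largest_antichain_size_def using assms by (intro Max_ge finite_imageI) auto
qed

lemma largest_antichain_size_attained:
  assumes "finite \<F>"
  obtains \<A> where "\<A> \<subseteq> \<F>" "antichain \<A>" "card \<A> = largest_antichain_size \<F>"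
proof -
  let ?S = "{\<A>. \<A> \<subseteq> \<F> \<and> antichain \<A>}"
  have "finite ?S" by (rule finite_subset[of _ "Pow \<F>"]) (use assms in auto)
  moreover have "{} \<in> ?S" by (simp add: antichain_def)
  ultimately have "Max (card ` ?S) \<in> card ` ?S" by (intro Max_in) auto
  then show ?thesis using that unfolding largest_antichain_size_def by auto
qed

lemma largest_antichain_size_le_card:
  assumes "finite \<F>" shows "largest_antichain_size \<F> \<le> card \<F>"
  by (rule largest_antichain_size_attained[OF assms]) (metis assms card_mono)

text \<open>A largest antichain either avoids \<open>v\<close>, which gives the first term, or
  contains \<open>v\<close>; then its other members avoid all proper supersets of \<open>v\<close>,
  and \<open>v\<close> itself accounts for the factor \<open>c\<close>.\<close>

lemma power_largest_antichain_size_insert: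
  fixes c :: real
  assumes "finite \<F>" "c \<ge> 1" "v \<notin> \<F>"
  shows "c ^ largest_antichain_size (insert v \<F>) \<le>
    c ^ largest_antichain_size \<F> + c * c ^ largest_antichain_size (\<F> - {B. v \<subset> B})"
proof -
  obtain \<A> where A: "\<A> \<subseteq> insert v \<F>" "antichain \<A>"
    "card \<A> = largest_antichain_size (insert v \<F>)"
    using largest_antichain_size_attained[of "insert v \<F>"] assms(1) by auto
  show ?thesis
  proof (cases "v \<in> \<A>")
    case False
    then have "card \<A> \<le> largest_antichain_size \<F>"
      using A assms by (intro largest_antichain_size_ge) auto
    then have "c ^ card \<A> \<le> c ^ largest_antichain_size \<F>"
      using assms by (intro power_increasing) auto
    then show ?thesis using A assms by (simp add: add_increasing2)
  next
    case True
    have "finite \<A>" using A assms finite_subset by blast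
    have "card (\<A> - {v}) \<le> largest_antichain_size (\<F> - {B. v \<subset> B})"
    proof (rule largest_antichain_size_ge)
      show "\<A> - {v} \<subseteq> \<F> - {B. v \<subset> B}"
        using A True unfolding antichain_def by blast
      show "antichain (\<A> - {v})" using A(2) by (rule antichain_subset) auto
    qed (use assms in auto)
    moreover have "card \<A> = Suc (card (\<A> - {v}))"
      using True \<open>finite \<A>\<close> by (metis card.remove)
    ultimately have "card \<A> \<le> Suc (largest_antichain_size (\<F> - {B. v \<subset> B}))" by simp
    then have "c ^ card \<A> \<le> c ^ Suc (largest_antichain_size (\<F> - {B. v \<subset> B}))"
      using assms by (intro power_increasing) auto
    then show ?thesis using A assms by (simp add: add_increasing)
  qed
qed

section \<open>The exponential moment and its recursion\<close>

text \<open>This is the quantity W of the overview, with \<open>c\<close> in the role of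
  \<lambda>.\<close>

definition antichain_moment :: "real \<Rightarrow> real \<Rightarrow> 'a set set \<Rightarrow> real" where
  "antichain_moment p c \<F> = subset_expectation p \<F> (\<lambda>\<R>. c ^ largest_antichain_size \<R>)"

lemma antichain_moment_le_exp:
  assumes "finite \<F>" "0 \<le> p" "p \<le> 1" "c \<ge> 1"
  shows "antichain_moment p c \<F> \<le> exp (p * (c - 1) * real (card \<F>))"
proof -
  have "antichain_moment p c \<F> \<le> subset_expectation p \<F> (\<lambda>\<R>. c ^ card \<R>)"
    unfolding antichain_moment_def using assms
    by (intro subset_expectation_mono power_increasing largest_antichain_size_le_card)
       (auto intro: finite_subset)
  also have "\<dots> = (1 + p * (c - 1)) ^ card \<F>"
    using assms by (simp add: subset_expectation_power_card)
  also have "\<dots> \<le> exp (p * (c - 1)) ^ card \<F>"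
    using assms by (intro power_mono exp_ge_add_one_self) auto
  also have "\<dots> = exp (p * (c - 1) * real (card \<F>))"
    by (simp add: exp_of_nat_mult[symmetric] mult.commute)
  finally show ?thesis .
qed

lemma antichain_moment_recursion:
  assumes "finite \<F>" "0 \<le> p" "p \<le> 1" "c \<ge> 1" "v \<in> \<F>"
  shows "antichain_moment p c \<F> \<le> antichain_moment p c (\<F> - {v})
    + p * c * antichain_moment p c (\<F> - {v} - {B. v \<subset> B})"
proof -
  define \<G> where "\<G> = \<F> - {v}"
  have G: "finite \<G>" "v \<notin> \<G>" "\<F> = insert v \<G>" using assms by (auto simp: \<G>_def)
  let ?g = "\<lambda>\<R>. c ^ largest_antichain_size \<R>"
  have "subset_expectation p \<G> (\<lambda>\<R>. ?g (insert v \<R>)) \<le>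
     subset_expectation p \<G> (\<lambda>\<R>. ?g \<R> + c * ?g (\<R> - {B. v \<subset> B}))"
    using assms G by (intro subset_expectation_mono power_largest_antichain_size_insert)
      (auto intro: finite_subset)
  also have "\<dots> = antichain_moment p c \<G> + c * antichain_moment p c (\<G> - {B. v \<subset> B})"
    using subset_expectation_restrict[OF G(1), of p ?g]
    by (simp add: subset_expectation_add subset_expectation_cmult antichain_moment_def)
  finally have "p * subset_expectation p \<G> (\<lambda>\<R>. ?g (insert v \<R>)) \<le>
     p * (antichain_moment p c \<G> + c * antichain_moment p c (\<G> - {B. v \<subset> B}))"
    using assms by (intro mult_left_mono)
  then show ?thesis
    unfolding antichain_moment_def \<G>_def[symmetric] unfolding G(3)
    using G by (simp add: subset_expectation_insert algebra_simps)
qed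

text \<open>Here \<open>x\<close> is the cost in the exponent per set. For a family of size k >
  \<open>N\<close>, the first term of the recursion loses one set and the second at least d + 1. By
  induction the moment is at most B exp(x (k - 1)) (1 + p c exp(-x d)), and the last factor is at
  most 1 + x, hence at most exp x.\<close>

lemma antichain_moment_descent:
  assumes "finite \<F>" "0 \<le> p" "p \<le> 1" "c \<ge> 1" "0 \<le> x" "0 \<le> B"
    and small: "\<And>\<G>. \<G> \<subseteq> \<F> \<Longrightarrow> real (card \<G>) \<le> N \<Longrightarrow> antichain_moment p c \<G> \<le> B"
    and large: "\<And>\<G>. \<G> \<subseteq> \<F> \<Longrightarrow> real (card \<G>) > N \<Longrightarrow>
      \<exists>v\<in>\<G>. d \<le> real (card {B\<in>\<G>. v \<subset> B})"
    and x: "p * c * exp (- x * d) \<le> x"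
  shows "antichain_moment p c \<F> \<le> B * exp (x * real (card \<F>))"
proof -
  have "\<G> \<subseteq> \<F> \<Longrightarrow> antichain_moment p c \<G> \<le> B * exp (x * real (card \<G>))" for \<G>
  proof (induction "card \<G>" arbitrary: \<G> rule: less_induct)
    case less
    have fin: "finite \<G>" using less.prems assms(1) finite_subset by blast
    show ?case
    proof (cases "real (card \<G>) \<le> N")
      case True
      have "B * 1 \<le> B * exp (x * real (card \<G>))"
        using assms by (intro mult_left_mono) auto
      then show ?thesis using small[OF less.prems True] by simp
    next
      case False
      then obtain v where v: "v \<in> \<G>" "d \<le> real (card {B\<in>\<G>. v \<subset> B})"
        using large[OF less.prems] by auto
      let ?U = "{B\<in>\<G>. v \<subset> B}" and ?k = "real (card \<G>)"
      have U: "?U \<subseteq> \<G> - {v}" by auto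
      have eq: "\<G> - {v} - {B. v \<subset> B} = \<G> - {v} - ?U" by auto
      have c1: "real (card (\<G> - {v})) = ?k - 1"
        using v(1) fin card_gt_0_iff[of \<G>] by (auto simp: card_Diff_singleton of_nat_diff)
      have "card (\<G> - {v} - ?U) = card (\<G> - {v}) - card ?U"
        using U fin by (intro card_Diff_subset) (auto intro: finite_subset)
      moreover have "card ?U \<le> card (\<G> - {v})" using U fin by (intro card_mono) auto
      \<comment> \<open>The extra 1 is \<open>v\<close> itself, which is not among its proper
        supersets.\<close>
      ultimately have c2: "real (card (\<G> - {v} - ?U)) \<le> ?k - 1 - d"
        using c1 v(2) by (simp add: of_nat_diff)
      have lt: "card (\<G> - {v} - ?U) < card \<G>" "card (\<G> - {v}) < card \<G>"
        using v(1) fin by (intro psubset_card_mono; auto)+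
      have "antichain_moment p c (\<G> - {v}) \<le> B * exp (x * (?k - 1))"
        using less.hyps[OF lt(2)] less.prems c1 by auto
      moreover have "antichain_moment p c (\<G> - {v} - ?U) \<le> B * exp (x * (?k - 1 - d))"
      proof -
        have "antichain_moment p c (\<G> - {v} - ?U) \<le> B * exp (x * real (card (\<G> - {v} - ?U)))"
          using less.hyps[OF lt(1)] less.prems by auto
        also have "\<dots> \<le> B * exp (x * (?k - 1 - d))"
          using assms c2 by (intro mult_left_mono) (auto intro: mult_left_mono)
        finally show ?thesis .
      qed
      ultimately have "antichain_moment p c \<G> \<le>
          B * exp (x * (?k - 1)) + p * c * (B * exp (x * (?k - 1 - d)))"
        using antichain_moment_recursion[OF fin assms(2-4) v(1)] assms(2,4) unfolding eq
        by (smt (verit, best) mult_left_mono mult_nonneg_nonneg)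
      also have "\<dots> = B * exp (x * (?k - 1)) * (1 + p * c * exp (- x * d))"
        using exp_add[of "x * (?k - 1)" "- x * d"] by (simp add: algebra_simps)
      also have "\<dots> \<le> B * exp (x * (?k - 1)) * exp x"
      proof (rule mult_left_mono)
        show "1 + p * c * exp (- x * d) \<le> exp x"
          using x exp_ge_add_one_self[of x] by linarith
      qed (use assms in auto)
      also have "\<dots> = B * exp (x * ?k)"
        by (simp add: algebra_simps exp_add[symmetric])
      finally show ?thesis .
    qed
  qed
  then show ?thesis by simp
qed

lemma prob_largest_antichain_size_gt:
  assumes "0 \<le> p" "p \<le> 1" "c > 1"
  shows "measure_pmf.prob (random_family n p) {\<F>. real (largest_antichain_size \<F>) > K}
    \<le> antichain_moment p c (Pow {1..n}) * exp (- K * ln c)"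
proof -
  let ?S = "{\<F>. real (largest_antichain_size \<F>) > K}"
  have "measure_pmf.prob (random_family n p) ?S =
      measure_pmf.expectation (random_family n p) (indicator ?S)" by simp
  also have "\<dots> = subset_expectation p (Pow {1..n}) (indicator ?S)"
    unfolding random_family_def using assms by (subst expectation_random_subset) auto
  also have "\<dots> \<le> subset_expectation p (Pow {1..n})
      (\<lambda>\<R>. exp (- K * ln c) * c ^ largest_antichain_size \<R>)"
  proof (rule subset_expectation_mono)
    fix \<R> :: "nat set set"
    \<comment> \<open>Markov's inequality pointwise: on the event the exponent is positive because
      \<open>c > 1\<close>; off the event the indicator vanishes.\<close>
    have "1 \<le> exp ((real (largest_antichain_size \<R>) - K) * ln c)" if "\<R> \<in> ?S"
      using that assms by simp
    also have "exp ((real (largest_antichain_size \<R>) - K) * ln c) =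
        exp (- K * ln c) * c ^ largest_antichain_size \<R>"
      using assms exp_of_nat_mult[of "largest_antichain_size \<R>" "ln c"]
      by (simp only: left_diff_distrib exp_diff) (simp add: exp_minus field_simps)
    finally show "indicator ?S \<R> \<le> exp (- K * ln c) * c ^ largest_antichain_size \<R>"
      using assms by (auto simp: indicator_def)
  qed (use assms in auto)
  also have "\<dots> = antichain_moment p c (Pow {1..n}) * exp (- K * ln c)"
    by (simp add: subset_expectation_cmult antichain_moment_def)
  finally show ?thesis .
qed

section \<open>Supersaturation\<close>

text \<open>An ordering of \<open>U\<close> encodes the maximal chain of its prefixes, which passes
  through \<open>A\<close> iff the first \<open>card A\<close> entries form \<open>A\<close>. Any
  ordering of \<open>A\<close> followed by any ordering of \<open>U - A\<close> does so.\<close>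

lemma card_permutations_prefix_ge:
  assumes "finite U" "A \<subseteq> U"
  shows "fact (card A) * fact (card U - card A) \<le>
    card {xs \<in> permutations_of_set U. set (take (card A) xs) = A}"
proof -
  let ?P = "permutations_of_set A \<times> permutations_of_set (U - A)"
  have fin: "finite A" using assms finite_subset by blast
  have len: "length us = card A" if "us \<in> permutations_of_set A" for us
    using that fin by (simp add: length_finite_permutations_of_set)
  have inj: "inj_on (\<lambda>(us, ws). us @ ws) ?P"
    by (auto simp: inj_on_def len)
  have "fact (card A) * fact (card U - card A) = card ((\<lambda>(us, ws). us @ ws) ` ?P)"
    using assms fin by (simp add: card_image[OF inj] card_cartesian_product card_Diff_subset)
  also have "\<dots> \<le> card {xs \<in> permutations_of_set U. set (take (card A) xs) = A}"
  proof (rule card_mono)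
    show "(\<lambda>(us, ws). us @ ws) ` ?P \<subseteq> {xs \<in> permutations_of_set U. set (take (card A) xs) = A}"
      using assms by (auto simp: permutations_of_set_def distinct_card[symmetric])
  qed simp
  finally show ?thesis .
qed

text \<open>Cutting such an ordering at positions \<open>card A\<close> and \<open>card B\<close>
  yields orderings of \<open>A\<close>, \<open>B - A\<close> and \<open>U - B\<close>, which
  determine it.\<close>

lemma card_permutations_two_prefixes_le:
  assumes "finite U" "A \<subseteq> B" "B \<subseteq> U"
  shows "card {xs \<in> permutations_of_set U. set (take (card A) xs) = A \<and> set (take (card B) xs) = B}
    \<le> fact (card A) * (fact (card B - card A) * fact (card U - card B))"
proof -
  let ?P = "permutations_of_set A \<times> permutations_of_set (B - A) \<times> permutations_of_set (U - B)"
  have fin: "finite A" "finite B" using assms by (meson finite_subset)+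
  have "{xs \<in> permutations_of_set U. set (take (card A) xs) = A \<and> set (take (card B) xs) = B}
    \<subseteq> (\<lambda>(us, vs, ws). us @ vs @ ws) ` ?P"
  proof
    fix xs
    assume xs: "xs \<in> {xs \<in> permutations_of_set U.
      set (take (card A) xs) = A \<and> set (take (card B) xs) = B}"
    define us vs ws where "us = take (card A) xs"
      and "vs = take (card B - card A) (drop (card A) xs)" and "ws = drop (card B) xs"
    have "card A \<le> card B" using assms fin by (intro card_mono)
    then have B: "us @ vs = take (card B) xs"
      unfolding us_def vs_def by (simp add: take_add[symmetric])
    have "us @ vs @ ws = xs"
      unfolding append_assoc[symmetric] B ws_def by simp
    moreover have "distinct xs" "set xs = U" using xs by (auto dest: permutations_of_setD)
    ultimately have eq: "us @ vs @ ws = xs" and d: "distinct (us @ vs @ ws)"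
      and U: "set us \<union> set vs \<union> set ws = U" by auto
    have "set us = A" using xs by (simp add: us_def)
    moreover have "set us \<union> set vs = B" using xs arg_cong[OF B, of set] by simp
    ultimately have "us \<in> permutations_of_set A" "vs \<in> permutations_of_set (B - A)"
      "ws \<in> permutations_of_set (U - B)"
      using d U by (auto intro!: permutations_of_setI)
    then show "xs \<in> (\<lambda>(us, vs, ws). us @ vs @ ws) ` ?P"
      using eq by force
  qed
  then have "card {xs \<in> permutations_of_set U. set (take (card A) xs) = A \<and>
      set (take (card B) xs) = B} \<le> card ?P"
    by (rule surj_card_le[rotated]) auto
  also have "\<dots> = fact (card A) * (fact (card B - card A) * fact (card U - card B))"
    using assms fin by (simp add: card_cartesian_product card_Diff_subset)
  finally show ?thesis .
qed

text \<open>Pairing the smallest chain member with all members at least \<open>t\<close> levels above it misses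
  at most \<open>t\<close> members.\<close>

lemma card_chain_le:
  fixes xs :: "'a list" and t :: nat
  assumes "finite \<F>"
  defines "\<C> \<equiv> {A \<in> \<F>. set (take (card A) xs) = A}"
  shows "card \<C> \<le> t + card {(A, B) \<in> \<C> \<times> \<C>. card A + t \<le> card B}"
proof (cases "\<C> = {}")
  case False
  have fin: "finite \<C>" using assms by simp
  obtain A where A: "A \<in> \<C>" "\<And>B. B \<in> \<C> \<Longrightarrow> card A \<le> card B"
    using False ex_has_least_nat[of "\<lambda>A. A \<in> \<C>" _ card] by blast
  \<comment> \<open>Two members of equal size are the same prefix of \<open>xs\<close>. Hence the
    near members have distinct sizes among \<open>t\<close> consecutive values.\<close>
  have inj: "inj_on card \<C>"
    by (rule inj_onI) (metis (mono_tags, lifting) \<C>_def mem_Collect_eq)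
  let ?near = "{B \<in> \<C>. card B < card A + t}" and ?far = "{B \<in> \<C>. card A + t \<le> card B}"
  have "card ?near = card (card ` ?near)"
    by (rule card_image[symmetric]) (rule inj_on_subset[OF inj], auto)
  also have "\<dots> \<le> card {card A..<card A + t}"
    using A by (intro card_mono) auto
  finally have "card ?near \<le> t" by simp
  moreover have "card ?far \<le> card {(A, B) \<in> \<C> \<times> \<C>. card A + t \<le> card B}"
    using A fin by (intro card_inj_on_le[of "Pair A"]) (auto simp: inj_on_def
        intro: finite_subset[of _ "\<C> \<times> \<C>"])
  moreover have "card \<C> \<le> card ?near + card ?far"
    using card_Un_le[of ?near ?far] by (simp add: Collect_disj_eq[symmetric]) 
      (metis (mono_tags, lifting) Collect_cong Collect_mem_eq linorder_le_less_linear)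
  ultimately show ?thesis by linarith
qed simp

lemma sum_card_swap:
  assumes "finite S" "finite T"
  shows "(\<Sum>x\<in>S. card {y \<in> T. Q x y}) = (\<Sum>y\<in>T. card {x \<in> S. Q x y})"
  using sum.swap_restrict[OF assms, of "\<lambda>_ _. 1::nat" Q] by simp

text \<open>\<open>card_chain_le\<close> summed over all orderings of \<open>U\<close>. Divided by
  \<open>fact (card U)\<close>, it says that a random maximal chain meets the family at most
  \<open>t\<close> times plus a bound for the expected number of pairs at least \<open>t\<close>
  levels apart.\<close>

lemma sum_fact_le_chain_pairs:
  assumes "finite U" "\<F> \<subseteq> Pow U"
  shows "(\<Sum>A\<in>\<F>. fact (card A) * fact (card U - card A)) \<le>
    t * fact (card U) + (\<Sum>(A, B)\<in>{(A, B) \<in> \<F> \<times> \<F>. A \<subseteq> B \<and> card A + t \<le> card B}.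
      fact (card A) * (fact (card B - card A) * fact (card U - card B) :: nat))"
proof -
  let ?S = "permutations_of_set U" and ?P = "\<lambda>xs A. set (take (card A) xs) = A"
  let ?T = "{(A, B) \<in> \<F> \<times> \<F>. A \<subseteq> B \<and> card A + t \<le> card B}"
  have fin: "finite \<F>" using assms finite_subset by blast
  then have finT: "finite ?T" by (auto intro: finite_subset[of _ "\<F> \<times> \<F>"])
  have "(\<Sum>A\<in>\<F>. fact (card A) * fact (card U - card A)) \<le> (\<Sum>A\<in>\<F>. card {xs \<in> ?S. ?P xs A})"
    using assms by (intro sum_mono card_permutations_prefix_ge) auto
  also have "\<dots> = (\<Sum>xs\<in>?S. card {A \<in> \<F>. ?P xs A})"
    using fin by (intro sum_card_swap) auto
  also have "\<dots> \<le> (\<Sum>xs\<in>?S. t + card {AB \<in> ?T. ?P xs (fst AB) \<and> ?P xs (snd AB)})"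
  proof (rule sum_mono)
    fix xs assume "xs \<in> ?S"
    have sub: "A \<subseteq> B" if "?P xs A" "?P xs B" "card A + t \<le> card B" for A B
      using set_take_subset_set_take[of "card A" "card B" xs] that by simp
    let ?C = "{A \<in> \<F>. ?P xs A}"
    have "card ?C \<le> t + card {(A, B) \<in> ?C \<times> ?C. card A + t \<le> card B}"
      using fin by (rule card_chain_le)
    also have "card {(A, B) \<in> ?C \<times> ?C. card A + t \<le> card B} \<le>
        card {AB \<in> ?T. ?P xs (fst AB) \<and> ?P xs (snd AB)}"
      using finT sub by (intro card_mono) auto
    finally show "card ?C \<le> t + card {AB \<in> ?T. ?P xs (fst AB) \<and> ?P xs (snd AB)}" by simp
  qed
  also have "\<dots> = t * fact (card U) +
      (\<Sum>AB\<in>?T. card {xs \<in> ?S. ?P xs (fst AB) \<and> ?P xs (snd AB)})"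
    using assms finT by (subst sum_card_swap[symmetric]) (auto simp: sum.distrib)
  also have "(\<Sum>AB\<in>?T. card {xs \<in> ?S. ?P xs (fst AB) \<and> ?P xs (snd AB)}) \<le>
     (\<Sum>(A, B)\<in>?T. fact (card A) * (fact (card B - card A) * fact (card U - card B)))"
  proof (rule sum_mono)
    fix AB assume "AB \<in> ?T"
    then show "card {xs \<in> ?S. ?P xs (fst AB) \<and> ?P xs (snd AB)} \<le>
      (case AB of (A, B) \<Rightarrow> fact (card A) * (fact (card B - card A) * fact (card U - card B)))"
      using assms card_permutations_two_prefixes_le[of U "fst AB" "snd AB"] by auto
  qed
  finally show ?thesis by simp
qed

text \<open>By symmetry and unimodality the binomial coefficient at \<open>k\<close> is at least the
  one at \<open>t\<close>.\<close>

lemma binomial_ge_power: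
  assumes "t \<le> k" "k + t \<le> N"
  shows "(real N / real t) ^ t \<le> real (N choose k)"
proof -
  have "N choose t \<le> N choose k"
  proof (cases "2 * k \<le> N")
    case True
    then show ?thesis using assms by (intro binomial_mono) auto
  next
    case False
    then have "N choose t \<le> N choose (N - k)" using assms by (intro binomial_mono) auto
    also have "\<dots> = N choose k" using assms by (intro binomial_symmetric[symmetric]) auto
    finally show ?thesis .
  qed
  moreover have "(real N / real t) ^ t \<le> real (N choose t)"
    using assms by (intro binomial_ge_n_over_k_pow_k) auto
  ultimately show ?thesis by linarith
qed

text \<open>The weight \<open>w A\<close> is n! times the probability that a random maximal chain
  passes through \<open>A\<close>. A pair at least \<open>t\<close> levels apart weighs at most w A
  / q, so bounded degrees make all pairs together weigh at most c times the total weight. Hence (1 -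
  c) times the total weight is at most t n!, while each member weighs at least n!/m.\<close>

lemma card_le_of_bounded_updegree:
  fixes c :: real
  defines "q \<equiv> \<lambda>n t. (real n / (4 * real t)) ^ t"
  assumes "finite U" "\<F> \<subseteq> Pow U" "card U = n" "1 \<le> t" "4 * t \<le> n" "c \<le> 1"
    and upper: "\<And>A. A \<in> \<F> \<Longrightarrow> 4 * card A \<le> 3 * n"
    and deg: "\<And>A. A \<in> \<F> \<Longrightarrow> real (card {B \<in> \<F>. A \<subset> B}) \<le> c * q n t"
  shows "(1 - c) * real (card \<F>) \<le> real t * real (n choose (n div 2))"
proof -
  define w :: "'a set \<Rightarrow> real" where "w A = fact (card A) * fact (n - card A)" for A
  define m where "m = real (n choose (n div 2))"
  let ?T = "{(A, B) \<in> \<F> \<times> \<F>. A \<subseteq> B \<and> card A + t \<le> card B}"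
  have fin: "finite \<F>" using assms finite_subset by blast
  have q: "q n t > 0" using assms(5,6) by (simp add: q_def)
  have m: "m > 0" by (simp add: m_def)
  have cardle: "card A \<le> n" if "A \<in> \<F>" for A
    using that assms by (metis PowD card_mono subsetD)
  have w: "fact n \<le> m * w A" if "A \<in> \<F>" for A
  proof -
    have "fact n = w A * real (n choose card A)"
      using binomial_fact_lemma[OF cardle[OF that], THEN arg_cong[of _ _ real]]
      by (simp add: w_def)
    also have "\<dots> \<le> w A * m"
      unfolding m_def w_def by (intro mult_left_mono) (auto simp: binomial_maximum)
    finally show ?thesis by (simp add: mult.commute)
  qed
  have pair: "fact (card A) * (fact (card B - card A) * fact (n - card B)) \<le> w A / q n t"
    if "A \<in> \<F>" "B \<in> \<F>" "card A + t \<le> card B" for A B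
  proof -
    let ?N = "n - card A" and ?k = "card B - card A"
    \<comment> \<open>Since \<open>B\<close> has at most 3n/4 elements and t \<le> n/4, at least
      \<open>t\<close> levels remain above \<open>B\<close>; likewise at least n/4 elements lie
      outside \<open>A\<close>.\<close>
    have "card B + t \<le> n" using upper[OF that(2)] assms(6) by linarith
    then have k: "t \<le> ?k" "?k + t \<le> ?N" using that by auto
    have N: "real n / 4 \<le> real ?N" using upper[OF that(1)] by linarith
    have "q n t \<le> (real ?N / real t) ^ t"
      unfolding q_def using N assms(5) by (intro power_mono) (auto simp: field_simps)
    also have "\<dots> \<le> real (?N choose ?k)" using k by (rule binomial_ge_power)
    finally have le: "q n t \<le> real (?N choose ?k)" .
    have "fact ?k * fact (?N - ?k) * real (?N choose ?k) = fact ?N"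
      using binomial_fact_lemma[of ?k ?N, THEN arg_cong[of _ _ real]] k by simp
    moreover have "?N - ?k = n - card B" using that(3) by simp
    ultimately have eq: "w A = fact (card A) * (fact ?k * fact (n - card B)) * real (?N choose ?k)"
      by (simp add: w_def)
    have "fact (card A) * (fact ?k * fact (n - card B)) * q n t \<le> w A"
      unfolding eq using le by (intro mult_left_mono) auto
    then show ?thesis using q by (simp add: field_simps)
  qed
  have "(\<Sum>A\<in>\<F>. w A) = real (\<Sum>A\<in>\<F>. fact (card A) * fact (card U - card A))"
    using assms(4) by (simp add: w_def)
  also have "\<dots> \<le> real (t * fact (card U) + (\<Sum>(A, B)\<in>?T.
      fact (card A) * (fact (card B - card A) * fact (card U - card B) :: nat)))"
    using sum_fact_le_chain_pairs[OF assms(2,3), of t] of_nat_le_iff by blast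
  also have "\<dots> = real t * fact n + (\<Sum>(A, B)\<in>?T.
      fact (card A) * (fact (card B - card A) * fact (n - card B)) :: real)"
    using assms(4) by (simp add: case_prod_unfold)
  also have "(\<Sum>(A, B)\<in>?T. fact (card A) * (fact (card B - card A) * fact (n - card B)) :: real) \<le>
      (\<Sum>(A, B)\<in>?T. w A / q n t)"
    using pair by (intro sum_mono) auto
  \<comment> \<open>As \<open>t\<close> is at least 1, separated pairs are strictly nested and so
    are counted by the degrees.\<close>
  also have "\<dots> \<le> (\<Sum>(A, B)\<in>(SIGMA A:\<F>. {B \<in> \<F>. A \<subset> B}). w A / q n t)"
    using fin q assms(5) by (intro sum_mono2) (auto simp: w_def)
  also have "\<dots> = (\<Sum>A\<in>\<F>. real (card {B \<in> \<F>. A \<subset> B}) * (w A / q n t))"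
    using fin by (subst sum.Sigma[symmetric]) auto
  also have "\<dots> \<le> (\<Sum>A\<in>\<F>. c * q n t * (w A / q n t))"
    using deg q by (intro sum_mono mult_right_mono) (auto simp: w_def)
  also have "\<dots> = c * (\<Sum>A\<in>\<F>. w A)"
    using q by (simp add: sum_distrib_left)
  finally have 1: "(1 - c) * (\<Sum>A\<in>\<F>. w A) \<le> t * fact n"
    by (simp add: algebra_simps)
  have "real (card \<F>) * fact n = (\<Sum>A\<in>\<F>. fact n)" by simp
  also have "\<dots> \<le> (\<Sum>A\<in>\<F>. m * w A)" using w by (intro sum_mono)
  finally have "real (card \<F>) * fact n \<le> m * (\<Sum>A\<in>\<F>. w A)" by (simp add: sum_distrib_left)
  then have "(1 - c) * (real (card \<F>) * fact n) \<le> (1 - c) * (m * (\<Sum>A\<in>\<F>. w A))"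
    using assms(7) by (intro mult_left_mono) auto
  also have "\<dots> = m * ((1 - c) * (\<Sum>A\<in>\<F>. w A))" by simp
  also have "\<dots> \<le> m * (t * fact n)" using 1 m by (intro mult_left_mono) auto
  finally have "(1 - c) * real (card \<F>) * fact n \<le> t * m * fact n"
    by (simp add: mult_ac)
  then show ?thesis unfolding m_def by (subst (asm) mult_le_cancel_right) auto
qed

section \<open>Sets far above the middle layer\<close>

lemma two_power_le_central_binomial: "2 ^ n \<le> (real n + 1) * real (n choose (n div 2))"
proof -
  have "(2::real) ^ n = real (\<Sum>k\<le>n. n choose k)" by (simp add: choose_row_sum)
  also have "\<dots> \<le> real (\<Sum>k\<le>n. n choose (n div 2))"
    by (intro of_nat_mono sum_mono binomial_maximum)
  finally show ?thesis by (simp add: algebra_simps)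
qed

text \<open>A Chernoff bound with base 3: under the uniform distribution the mean of 3^|A| is 2^n,
  so these powers sum to 4^n, while each set in the tail contributes at least 3^(3n/4).\<close>

lemma card_upper_tail_le:
  assumes "finite U" "card U = n"
  shows "real (card {A \<in> Pow U. 3 * n < 4 * card A}) \<le> 4 ^ n / 3 powr (3 * real n / 4)"
proof -
  let ?T = "{A \<in> Pow U. 3 * n < 4 * card A}" and ?b = "3 powr (3 * real n / 4) :: real"
  have "subset_expectation (1/2) U (\<lambda>A. 3 ^ card A) = (\<Sum>A\<in>Pow U. 3 ^ card A / 2 ^ n)"
    unfolding subset_expectation_def
  proof (rule sum.cong)
    fix A assume "A \<in> Pow U"
    then have "card A + card (U - A) = n"
      using assms by (metis PowD card_Diff_subset card_mono finite_subset le_add_diff_inverse)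
    then have "(1/2::real) ^ card A * (1 - 1/2) ^ card (U - A) = 1 / 2 ^ n"
      by (simp add: power_add[symmetric] power_divide)
    then show "(1/2::real) ^ card A * (1 - 1/2) ^ card (U - A) * 3 ^ card A = 3 ^ card A / 2 ^ n"
      by simp
  qed simp
  also have "\<dots> = (\<Sum>A\<in>Pow U. 3 ^ card A) / 2 ^ n" by (simp add: sum_divide_distrib)
  finally have "(\<Sum>A\<in>Pow U. 3 ^ card A) = (2 ^ n * 2 ^ n :: real)"
    using assms by (simp add: subset_expectation_power_card field_simps)
  also have "\<dots> = 4 ^ n" by (simp add: power_mult_distrib[symmetric])
  finally have sum: "(\<Sum>A\<in>Pow U. 3 ^ card A) = (4 ^ n :: real)" .
  have "real (card ?T) * ?b = (\<Sum>A\<in>?T. ?b)" by simp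
  also have "\<dots> \<le> (\<Sum>A\<in>?T. 3 ^ card A)"
  proof (rule sum_mono)
    fix A assume "A \<in> ?T"
    then have "?b \<le> 3 powr real (card A)" by (intro powr_mono) auto
    then show "?b \<le> 3 ^ card A" by (simp add: powr_realpow)
  qed
  also have "\<dots> \<le> (\<Sum>A\<in>Pow U. 3 ^ card A)"
    using assms by (intro sum_mono2) auto
  finally show ?thesis by (simp add: sum field_simps)
qed

lemma eventually_upper_tail_small:
  assumes "\<delta> > 0"
  shows "\<forall>\<^sub>F n in sequentially. real (card {A \<in> Pow {1..n}. 3 * n < 4 * card A}) \<le>
    \<delta> * real (n choose (n div 2))"
proof -
  define r :: real where "r = 2 / 3 powr (3 / 4)"
  \<comment> \<open>This is 16 < 27; it makes the tail exponentially small relative to 2^n.\<close>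
  have "(2::real) ^ 4 < (3 powr (3 / 4)) ^ 4"
    by (simp add: powr_realpow[symmetric] powr_powr)
  then have "2 < (3 powr (3 / 4) :: real)" by (rule power_less_imp_less_base) simp
  then have "norm r < 1" by (simp add: r_def)
  then have "(\<lambda>n. real n * r ^ n + r ^ n) \<longlonglongrightarrow> 0 + 0"
    by (intro tendsto_add powser_times_n_limit_0 LIMSEQ_power_zero)
  moreover have "3 powr (3 * real n / 4) = (3 powr (3 / 4) :: real) ^ n" for n
    by (simp add: powr_realpow[symmetric] powr_powr)
  ultimately have "(\<lambda>n. (real n + 1) * (2 ^ n / 3 powr (3 * real n / 4))) \<longlonglongrightarrow> 0"
    by (simp add: r_def power_divide distrib_right add_divide_distrib)
  then have "\<forall>\<^sub>F n in sequentially. (real n + 1) * (2 ^ n / 3 powr (3 * real n / 4)) < \<delta>"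
    using assms by (rule order_tendstoD)
  then show ?thesis
  proof eventually_elim
    case (elim n)
    let ?b = "3 powr (3 * real n / 4) :: real" and ?m = "real (n choose (n div 2))"
    have "real (card {A \<in> Pow {1..n}. 3 * n < 4 * card A}) \<le> 4 ^ n / ?b"
      by (intro card_upper_tail_le) auto
    also have "\<dots> = 2 ^ n * (2 ^ n / ?b)" by (simp add: power_mult_distrib[symmetric])
    also have "\<dots> \<le> (real n + 1) * ?m * (2 ^ n / ?b)"
      by (intro mult_right_mono two_power_le_central_binomial) auto
    also have "\<dots> = (real n + 1) * (2 ^ n / ?b) * ?m" by simp
    also have "\<dots> \<le> \<delta> * ?m" using elim by (intro mult_right_mono) auto
    finally show ?case .
  qed
qed

text \<open>Removing the sets with more than 3n/4 elements costs at most \<delta> m / 2, after which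
  \<open>card_le_of_bounded_updegree\<close> applies to the rest.\<close>

lemma eventually_large_updegree:
  fixes \<delta> :: real and t :: nat
  assumes "\<delta> > 0" "t \<ge> 1"
  shows "\<exists>c>0. \<forall>\<^sub>F n in sequentially. \<forall>\<F> \<subseteq> Pow {1..n}.
    real (card \<F>) > (real t + \<delta>) * real (n choose (n div 2)) \<longrightarrow>
    (\<exists>A\<in>\<F>. c * real n ^ t \<le> real (card {B \<in> \<F>. A \<subset> B}))"
proof -
  \<comment> \<open>Chosen so that t / (1 - \<kappa>) = t + \<delta>/2; \<open>c\<close> then
    absorbs the factor (4t)^t of the degree bound.\<close>
  define \<kappa> where "\<kappa> = (\<delta> / 2) / (real t + \<delta> / 2)"
  define c where "c = \<kappa> / (4 * real t) ^ t"
  have \<kappa>: "0 < \<kappa>" "\<kappa> < 1" "(1 - \<kappa>) * (real t + \<delta> / 2) = real t"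
    using assms by (auto simp: \<kappa>_def field_simps)
  have "c > 0" using \<kappa> assms by (simp add: c_def)
  have "\<forall>\<^sub>F n in sequentially. real (card {A \<in> Pow {1..n}. 3 * n < 4 * card A}) \<le>
      \<delta> / 2 * real (n choose (n div 2))"
    using assms by (intro eventually_upper_tail_small) simp
  then have "\<forall>\<^sub>F n in sequentially. \<forall>\<F> \<subseteq> Pow {1..n}.
    real (card \<F>) > (real t + \<delta>) * real (n choose (n div 2)) \<longrightarrow>
    (\<exists>A\<in>\<F>. c * real n ^ t \<le> real (card {B \<in> \<F>. A \<subset> B}))"
    using eventually_ge_at_top[of "4 * t"]
  proof (eventually_elim, intro allI impI)
    fix n \<F>
    let ?m = "real (n choose (n div 2))"
    let ?T = "{A \<in> Pow {1..n}. 3 * n < 4 * card A}"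
    assume tail: "real (card ?T) \<le> \<delta> / 2 * ?m" and n: "4 * t \<le> n"
      and F: "\<F> \<subseteq> Pow {1..n}" and large: "(real t + \<delta>) * ?m < real (card \<F>)"
    define \<G> where "\<G> = {A \<in> \<F>. 4 * card A \<le> 3 * n}"
    have fin: "finite \<F>" using F finite_subset by blast
    show "\<exists>A\<in>\<F>. c * real n ^ t \<le> real (card {B \<in> \<F>. A \<subset> B})"
    proof (rule ccontr)
      assume neg: "\<not> ?thesis"
      have "(1 - \<kappa>) * real (card \<G>) \<le> real t * ?m"
      proof (rule card_le_of_bounded_updegree[where U = "{1..n}"])
        fix A assume A: "A \<in> \<G>"
        have "card {B \<in> \<G>. A \<subset> B} \<le> card {B \<in> \<F>. A \<subset> B}"
          using fin by (intro card_mono) (auto simp: \<G>_def)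
        also have "real (card {B \<in> \<F>. A \<subset> B}) \<le> c * real n ^ t"
          using A neg by (force simp: \<G>_def)
        also have "c * real n ^ t = \<kappa> * (real n / (4 * real t)) ^ t"
          by (simp add: c_def power_divide)
        finally show "real (card {B \<in> \<G>. A \<subset> B}) \<le> \<kappa> * (real n / (4 * real t)) ^ t"
          by simp
      qed (use F n assms \<kappa> in \<open>auto simp: \<G>_def\<close>)
      also have "\<dots> = (1 - \<kappa>) * ((real t + \<delta> / 2) * ?m)"
        using \<kappa>(3) by (simp add: mult.assoc[symmetric])
      finally have "real (card \<G>) \<le> (real t + \<delta> / 2) * ?m"
        using \<kappa>(2) by (subst (asm) mult_le_cancel_left_pos) auto
      moreover have "card \<F> \<le> card (\<G> \<union> ?T)"
        using F fin by (intro card_mono) (auto simp: \<G>_def)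
      moreover have "card (\<G> \<union> ?T) \<le> card \<G> + card ?T" by (rule card_Un_le)
      ultimately show False using tail large by (simp add: algebra_simps)
    qed
  qed
  with \<open>c > 0\<close> show ?thesis by blast
qed
section \<open>The largest antichain in a random family\<close>

text \<open>The two descents for fixed \<open>n\<close>, with moment base 1 + \<eta>. The unit of
  slack is \<beta> p m, and four units are available: one for the excess \<delta> in the family
  size, one for each descent, and one left as the final exponent.\<close>

lemma prob_large_antichain_le_exp:
  fixes \<epsilon> c c' p :: real and t n :: nat
  defines "m \<equiv> real (n choose (n div 2))" and "\<delta> \<equiv> \<epsilon> / 8" and "\<eta> \<equiv> \<epsilon> / (2 * (1 + \<epsilon>))"
  defines "\<beta> \<equiv> \<eta> * \<epsilon> * real t / 8"
  defines "\<delta>' \<equiv> \<beta> / (real t + 3 + \<delta>)"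
  assumes "\<epsilon> > 0" "t \<ge> 1" "n \<ge> 1" "0 \<le> p" "p \<le> 1" and pn: "p * real n ^ t \<ge> 1"
    and deg: "\<And>\<G>. \<G> \<subseteq> Pow {1..n} \<Longrightarrow> real (card \<G>) > (real t + \<delta>) * m \<Longrightarrow>
      \<exists>A\<in>\<G>. c * real n ^ t \<le> real (card {B\<in>\<G>. A \<subset> B})"
    and deg': "\<And>\<G>. \<G> \<subseteq> Pow {1..n} \<Longrightarrow> real (card \<G>) > (real t + 3 + \<delta>) * m \<Longrightarrow>
      \<exists>A\<in>\<G>. c' * real n ^ (t + 3) \<le> real (card {B\<in>\<G>. A \<subset> B})"
    and C: "(1 + \<eta>) * exp (- \<delta>' * (c * (p * real n ^ t))) \<le> \<delta>'"
    and n1: "(1 + \<eta>) * exp (- c' * real n) \<le> 1 / real n ^ (t + 2)"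
    and n2: "(real n + 1) / real n ^ 2 \<le> \<beta>"
  shows "measure_pmf.prob (random_family n p)
      {\<F>. real (largest_antichain_size \<F>) > (1 + \<epsilon>) * p * m * real t} \<le> exp (- \<beta> * (p * m))"
proof -
  let ?M = "antichain_moment p (1 + \<eta>)" and ?x = "1 / real n ^ (t + 2)"
  have \<eta>: "0 < \<eta>" "\<eta> \<le> 1" "(1 + \<epsilon>) * (1 - \<eta>) = 1 + \<epsilon> / 2"
    using \<open>\<epsilon> > 0\<close> by (auto simp: \<eta>_def field_simps)
  have pos: "m > 0" "\<delta> > 0" "\<beta> > 0" "\<delta>' > 0"
    using \<open>\<epsilon> > 0\<close> \<open>t \<ge> 1\<close> \<eta> by (auto simp: m_def \<delta>_def \<beta>_def \<delta>'_def intro!: divide_pos_pos add_pos_pos)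
  have fin: "finite \<G>" if "\<G> \<subseteq> Pow {1..n}" for \<G>
    using that by (rule finite_subset) simp
  define B where "B = exp (p * \<eta> * ((real t + \<delta>) * m))"
  have small: "?M \<G> \<le> B" if "\<G> \<subseteq> Pow {1..n}" "real (card \<G>) \<le> (real t + \<delta>) * m" for \<G>
  proof -
    have "?M \<G> \<le> exp (p * \<eta> * real (card \<G>))"
      using antichain_moment_le_exp[OF fin[OF that(1)], of p "1 + \<eta>"] \<eta> assms(9,10) by simp
    also have "\<dots> \<le> B"
      unfolding B_def using that(2) \<eta> assms(9) by (auto intro!: mult_left_mono)
    finally show ?thesis .
  qed
  have mid: "?M \<G> \<le> B * exp (\<beta> * (p * m))"
    if \<G>: "\<G> \<subseteq> Pow {1..n}" "real (card \<G>) \<le> (real t + 3 + \<delta>) * m" for \<G>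
  proof -
    have "?M \<G> \<le> B * exp (p * \<delta>' * real (card \<G>))"
    \<comment> \<open>Second stage of the descent, with cost p \<delta>' per set. Its admissibility
      is \<open>C\<close> multiplied by \<open>p\<close>, and \<delta>' is scaled so that (t + 3 +
      \<delta>) m sets cost exactly \<beta> p m.\<close>
    proof (rule antichain_moment_descent[where N = "(real t + \<delta>) * m" and d = "c * real n ^ t"])
      have "p * ((1 + \<eta>) * exp (- \<delta>' * (c * (p * real n ^ t)))) \<le> p * \<delta>'"
        using C assms(9) by (rule mult_left_mono)
      then show "p * (1 + \<eta>) * exp (- (p * \<delta>') * (c * real n ^ t)) \<le> p * \<delta>'"
        by (simp add: mult_ac)
    qed (use assms(9,10) \<eta> pos small deg \<G>(1) fin[OF \<G>(1)] in \<open>auto simp: B_def\<close>)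
    also have "p * \<delta>' * real (card \<G>) \<le> p * \<delta>' * ((real t + 3 + \<delta>) * m)"
      using \<G>(2) assms(9) pos by (intro mult_left_mono) auto
    also have "\<dots> = \<beta> * (p * m)"
      using pos by (simp add: \<delta>'_def field_simps)
    finally show ?thesis by (simp add: B_def)
  qed
  \<comment> \<open>First stage, started from the full power set. Of the three extra powers of n in
    the degree, one makes the product of cost and degree equal to c' n; the other two keep the total
    cost below \<beta> p m.\<close>
  have "?M (Pow {1..n}) \<le> B * exp (\<beta> * (p * m)) * exp (?x * real (card (Pow {1..n})))"
  proof (rule antichain_moment_descent[where N = "(real t + 3 + \<delta>) * m"
        and d = "c' * real n ^ (t + 3)"])
    have "?x * (c' * real n ^ (t + 3)) = c' * real n"
      using \<open>n \<ge> 1\<close> by (simp add: power_add eval_nat_numeral)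
    then have "exp (- ?x * (c' * real n ^ (t + 3))) = exp (- c' * real n)"
      by (simp only: minus_mult_left[symmetric])
    moreover have "p * ((1 + \<eta>) * exp (- c' * real n)) \<le> 1 * ?x"
      using n1 assms(9,10) \<eta> by (intro mult_mono) auto
    ultimately show "p * (1 + \<eta>) * exp (- ?x * (c' * real n ^ (t + 3))) \<le> ?x"
      by (simp only: mult.assoc mult_1)
  qed (use assms(9,10) \<eta> mid deg' in \<open>auto simp: B_def\<close>)
  also have "?x * real (card (Pow {1..n})) \<le> \<beta> * (p * m)"
  proof -
    have "?x * real (card (Pow {1..n})) = ?x * 2 ^ n" by (simp add: card_Pow)
    also have "\<dots> \<le> ?x * ((real n + 1) * m)"
      unfolding m_def by (intro mult_left_mono two_power_le_central_binomial) auto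
    also have "\<dots> = (real n + 1) / real n ^ 2 * (1 / real n ^ t) * m"
      by (simp add: power_add power2_eq_square)
    also have "\<dots> \<le> \<beta> * p * m"
    proof (intro mult_right_mono mult_mono)
      show "1 / real n ^ t \<le> p" using pn \<open>n \<ge> 1\<close> by (simp add: field_simps)
    qed (use n2 pos in auto)
    finally show ?thesis by (simp add: mult.assoc)
  qed
  finally have "?M (Pow {1..n}) \<le> B * exp (\<beta> * (p * m)) * exp (\<beta> * (p * m))"
    by (simp add: B_def)
  moreover define X b where "X = p * \<eta> * ((real t + \<delta>) * m)" and "b = \<beta> * (p * m)"
  ultimately have M: "?M (Pow {1..n}) \<le> exp (X + b + b)"
    by (simp only: B_def exp_add)
  let ?K = "(1 + \<epsilon>) * p * m * real t"
  \<comment> \<open>From ln(1 + \<eta>) \<ge> \<eta> - \<eta>^2; the choice of \<eta> turns (1 +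
    \<epsilon>)(1 - \<eta>) into 1 + \<epsilon>/2, whose surplus is the four units
    \<open>b\<close>.\<close>
  have "\<eta> * (1 - \<eta>) \<le> ln (1 + \<eta>)"
    using ln_one_plus_pos_lower_bound[of \<eta>] \<eta> by (simp add: algebra_simps power2_eq_square)
  then have "?K * (\<eta> * (1 - \<eta>)) \<le> ?K * ln (1 + \<eta>)"
    using pos \<open>\<epsilon> > 0\<close> assms(9) by (intro mult_left_mono) auto
  also have "?K * (\<eta> * (1 - \<eta>)) = ((1 + \<epsilon>) * (1 - \<eta>)) * (\<eta> * (p * m) * real t)"
    by simp
  also have "\<dots> = \<eta> * real t * (p * m) + 4 * b"
    unfolding \<eta>(3) by (simp add: b_def \<beta>_def algebra_simps)
  finally have K: "\<eta> * real t * (p * m) + 4 * b \<le> ?K * ln (1 + \<eta>)" .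
  have "\<eta> * \<delta> \<le> \<beta>"
    using \<eta> \<open>\<epsilon> > 0\<close> \<open>t \<ge> 1\<close> by (simp add: \<beta>_def \<delta>_def)
  then have "\<eta> * \<delta> * (p * m) \<le> b"
    unfolding b_def using assms(9) pos by (intro mult_right_mono) auto
  then have "X \<le> \<eta> * real t * (p * m) + b"
    by (simp add: X_def algebra_simps)
  with K have expo: "X + b + b + - (?K * ln (1 + \<eta>)) \<le> - b"
    by simp
  have "measure_pmf.prob (random_family n p) {\<F>. real (largest_antichain_size \<F>) > ?K} \<le>
      ?M (Pow {1..n}) * exp (- (?K * ln (1 + \<eta>)))"
    using prob_largest_antichain_size_gt[of p "1 + \<eta>" n ?K] \<eta> assms(9,10) by simp
  also have "\<dots> \<le> exp (X + b + b) * exp (- (?K * ln (1 + \<eta>)))"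
    using M by (rule mult_right_mono) simp
  also have "\<dots> \<le> exp (- \<beta> * (p * m))"
    unfolding exp_add[symmetric] using expo by (simp add: b_def)
  finally show ?thesis .
qed

theorem theorem2:
  fixes \<epsilon> :: real and t :: nat
  assumes "\<epsilon> > 0" and "t \<ge> 1"
  shows "\<exists>C::real. \<forall>p :: nat \<Rightarrow> real.
    (\<forall>n\<ge>1. 0 \<le> p n \<and> p n \<le> 1) \<longrightarrow>
    (\<forall>\<^sub>F n in sequentially. p n > C / real n ^ t) \<longrightarrow>
    (\<lambda>n. measure_pmf.prob (random_family n (p n))
       {\<F>. real (largest_antichain_size \<F>)
            \<le> (1 + \<epsilon>) * p n * real (n choose (n div 2)) * real t})
      \<longlonglongrightarrow> 1"
proof -
  define \<delta> \<eta> where "\<delta> = \<epsilon> / 8" and "\<eta> = \<epsilon> / (2 * (1 + \<epsilon>))"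
  define \<beta> where "\<beta> = \<eta> * \<epsilon> * real t / 8"
  define \<delta>' where "\<delta>' = \<beta> / (real t + 3 + \<delta>)"
  have pos: "\<delta> > 0" "\<eta> > 0" "\<beta> > 0" "\<delta>' > 0"
    using assms by (auto simp: \<delta>_def \<eta>_def \<beta>_def \<delta>'_def intro!: divide_pos_pos add_pos_pos)
  obtain c where c: "c > 0" "\<forall>\<^sub>F n in sequentially. \<forall>\<F> \<subseteq> Pow {1..n}.
      real (card \<F>) > (real t + \<delta>) * real (n choose (n div 2)) \<longrightarrow>
      (\<exists>A\<in>\<F>. c * real n ^ t \<le> real (card {B \<in> \<F>. A \<subset> B}))"
    using eventually_large_updegree[OF pos(1) assms(2)] by blast
  obtain c' where c': "c' > 0" "\<forall>\<^sub>F n in sequentially. \<forall>\<F> \<subseteq> Pow {1..n}.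
      real (card \<F>) > (real (t + 3) + \<delta>) * real (n choose (n div 2)) \<longrightarrow>
      (\<exists>A\<in>\<F>. c' * real n ^ (t + 3) \<le> real (card {B \<in> \<F>. A \<subset> B}))"
    using eventually_large_updegree[OF pos(1), of "t + 3"] by force
  \<comment> \<open>The 1 ensures p n^t \<ge> 1; the other term solves (1 + \<eta>) exp(-\<delta>' c
    y) \<le> \<delta>' for y = p n^t.\<close>
  define C where "C = max 1 (ln ((1 + \<eta>) / \<delta>') / (\<delta>' * c))"
  show ?thesis
  proof (intro exI[of _ C] allI impI)
    fix p :: "nat \<Rightarrow> real"
    assume p01: "\<forall>n\<ge>1. 0 \<le> p n \<and> p n \<le> 1"
      and pC: "\<forall>\<^sub>F n in sequentially. p n > C / real n ^ t"
    let ?m = "\<lambda>n. real (n choose (n div 2))"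
    let ?good = "\<lambda>n. {\<F>. real (largest_antichain_size \<F>) \<le> (1 + \<epsilon>) * p n * ?m n * real t}"
    let ?P = "\<lambda>n. measure_pmf.prob (random_family n (p n)) (?good n)"
    \<comment> \<open>A lower bound for \<beta> p m that does not involve \<open>p\<close>, from p
      \<ge> n^-t and m \<ge> 2^n/(n + 1); it tends to infinity.\<close>
    define g where "g n = \<beta> * (2 ^ n / ((real n + 1) * real n ^ t))" for n
    have "\<forall>\<^sub>F n in sequentially. (1 + \<eta>) * exp (- c' * real n) * real n ^ (t + 2) < 1"
      by (rule order_tendstoD(2)[of _ 0]) (use c'(1) in real_asymp, simp)
    moreover have "\<forall>\<^sub>F n in sequentially. (real n + 1) / real n ^ 2 < \<beta>"
      by (rule order_tendstoD(2)[of _ 0]) (real_asymp, use pos in simp)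
    ultimately have lower: "\<forall>\<^sub>F n in sequentially. 1 - exp (- g n) \<le> ?P n"
      using pC c(2) c'(2) eventually_ge_at_top[of 1]
    proof eventually_elim
      case (elim n)
      have C1: "C \<le> p n * real n ^ t" using elim(3,6) by (simp add: field_simps)
      then have pn: "1 \<le> p n * real n ^ t" by (simp add: C_def)
      have "ln ((1 + \<eta>) / \<delta>') / (\<delta>' * c) \<le> p n * real n ^ t"
        using C1 by (simp add: C_def)
      then have "ln ((1 + \<eta>) / \<delta>') \<le> \<delta>' * (c * (p n * real n ^ t))"
        using pos c(1) by (simp add: field_simps)
      then have "exp (- (\<delta>' * (c * (p n * real n ^ t)))) \<le> exp (- ln ((1 + \<eta>) / \<delta>'))" by simp
      also have "\<dots> = \<delta>' / (1 + \<eta>)" using pos by (simp add: exp_minus)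
      finally have C2: "(1 + \<eta>) * exp (- \<delta>' * (c * (p n * real n ^ t))) \<le> \<delta>'"
        using pos by (simp add: field_simps)
      have "g n \<le> \<beta> * (p n * ?m n)"
      proof -
        have "2 ^ n / (real n + 1) \<le> ?m n"
          using two_power_le_central_binomial[of n] by (simp add: field_simps)
        then have "2 ^ n / ((real n + 1) * real n ^ t) \<le> ?m n / real n ^ t"
          unfolding divide_divide_eq_left[symmetric] by (rule divide_right_mono) simp
        also have "\<dots> \<le> p n * ?m n"
          using mult_right_mono[OF pn, of "?m n"] elim(6) by (simp add: field_simps)
        finally show ?thesis unfolding g_def using pos by (intro mult_left_mono) auto
      qed
      have "1 - ?P n = measure_pmf.prob (random_family n (p n)) (UNIV - ?good n)"
        using measure_pmf.prob_compl[of "?good n" "random_family n (p n)"] by simp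
      also have "UNIV - ?good n =
          {\<F>. real (largest_antichain_size \<F>) > (1 + \<epsilon>) * p n * ?m n * real t}"
        by auto
      also have "measure_pmf.prob (random_family n (p n)) \<dots> \<le> exp (- \<beta> * (p n * ?m n))"
        unfolding \<beta>_def \<eta>_def
      \<comment> \<open>The applied lemma has its abbreviations expanded; they are folded back from
        the innermost outwards.\<close>
      proof (rule prob_large_antichain_le_exp[where c = c and c' = c'], unfold \<eta>_def[symmetric],
          unfold \<beta>_def[symmetric], unfold \<delta>_def[symmetric], unfold \<delta>'_def[symmetric])
        show "(1 + \<eta>) * exp (- c' * real n) \<le> 1 / real n ^ (t + 2)"
          using elim(1,6) by (simp add: field_simps)
      qed (use assms elim p01 pn C2 in auto)
      also have "\<dots> \<le> exp (- g n)" using \<open>g n \<le> \<beta> * (p n * ?m n)\<close> by simp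
      finally show ?case by simp
    qed
    have lim: "(\<lambda>n. 1 - exp (- g n)) \<longlonglongrightarrow> 1"
      unfolding g_def using pos(3) by real_asymp
    show "?P \<longlonglongrightarrow> 1"
      by (rule tendsto_sandwich[OF lower _ lim tendsto_const]) simp
  qed
qed
end
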